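(* Let $\alpha=(\alpha_n)_{n\in\mathbb{N}}$ and $\beta=(\beta_n)_{n\in\mathbb{N}}$ be exponent sequences such that $\beta$ is stable and $\Lambda_\infty(\alpha)$ is nuclear. Let $\theta=(\theta_j)_{j\in\mathbb{Z}}$ be a two-sided scalar sequence. If $\theta\in \Lambda_\infty(\beta)\oplus(\Lambda_\infty(\alpha))'$ and $$\forall k\in\mathbb{N}\ \exists m\in\mathbb{N},\,C>0\ \ \forall n\ge k:\quad e^{k\beta_n}\le C e^{m\alpha_n},$$ then the Toeplitz operator $T_\theta:\Lambda_\infty(\alpha)\to\Lambda_\infty(\beta)$ is well-defined and continuous.
   Context: $\mathbb{N}=\{1,2,3,\dots\}$. An exponent sequence is a non-negative increasing sequence $\alpha=(\alpha_n)_{n\in\mathbb{N}}$ with $\lim_n\alpha_n=\infty$. It is stable if $\sup_n \alpha_{2n}/\alpha_n<\infty$ (i.e. there is $M$ with $\alpha_{2n}\le M\alpha_n$ for all $n$). The power series space of infinite type is $\Lambda_\infty(\alpha)=\{x=(x_n)_{n\in\mathbb{N}}: \|x\|_k:=\sum_n|x_n|e^{k\alpha_n}<\infty\ \forall k\in\mathbb{N}\}$, a Fréchet space with the seminorms $\|\cdot\|_k$. It is nuclear iff for every $k$ there is $l>k$ with $\sum_n e^{(k-l)\alpha_n}<\infty$. Its dual is identified with the sequence space $(\Lambda_\infty(\alpha))'=\{y=(y_n)_{n\in\mathbb{N}}: \sup_n|y_n|e^{-k\alpha_n}<\infty\text{ for some }k\in\mathbb{N}\}$. $e_n$ is the sequence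 with $1$ in the $n$-th place and $0$ elsewhere. A one-sided sequence $(\eta_0,\eta_1,\eta_2,\dots)$ is regarded as an element of a sequence space indexed by $\mathbb{N}$ by letting its $n$-th coordinate be $\eta_{n-1}$. For such $\eta$ let $\hat T_\eta e_n=\sum_{j=n}^\infty \eta_{j-n}e_j$ and $\check T_\eta e_n=\sum_{j=1}^n\eta_{n-j}e_j$, extended to $x=\sum_n x_ne_n$ by $\hat T_\eta x=\sum_n x_n\hat T_\eta e_n$, $\check T_\eta x=\sum_n x_n\check T_\eta e_n$; well-defined means that the images of the $e_n$ lie in the target space and the series converge in the target space for every $x$ in the domain. Toeplitz operator: for $\theta=(\theta_j)_{j\in\mathbb{Z}}$ write $\theta_0=\theta_0'+\theta_0''$ with $\theta_0',\theta_0''$ both non-zero, and set $\hat\theta=(\theta_0',\theta_1,\theta_2,\dots)$, $\check\theta=(\theta_0'',\theta_{-1},\theta_{-2},\dots)$. Then $T_\theta:=\hat T_{\hat\theta}+\check T_{\check\theta}$, i.e. the operator whose matrix with respect to $(e_n)$ is the Toeplitz matrix with $(i,j)$ entry $\theta_{i-j}$. The notation $\theta\in\Lambda_\infty(\beta)\oplus(\Lambda_\infty(\alpha))'$ means $\hat\theta\in\Lambda_\infty(\beta)$ and $\check\theta\in(\Lambda_\infty(\alpha))'$. Standing assumption: each of the symbol sequences $\hat\theta$ and $\check\theta$ has infinitely many non-zero terms. *)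

theory Defs
  imports "HOL-Analysis.Analysis"
begin

text \<open>
  A sequence \<open>(x\<^sub>n)\<close> indexed by \<open>{1, 2, 3, \<dots>}\<close> is a function on \<^typ>\<open>nat\<close> of which only the
  values at arguments \<open>\<ge> 1\<close> matter. For elements of the sequence spaces the value at \<open>0\<close> is
  fixed to be \<open>0\<close>, so that equality of functions is equality of sequences.
  The class \<open>{real_normed_field, banach}\<close> of the scalars comprises the reals and the complex
  numbers.
\<close>

section \<open>Exponent sequences\<close>

definition exponent_seq :: "(nat \<Rightarrow> real) \<Rightarrow> bool" where
  "exponent_seq \<alpha> \<longleftrightarrow>
     (\<forall>n\<ge>1. 0 \<le> \<alpha> n) \<and> mono_on {1..} \<alpha> \<and> filterlim \<alpha> at_top sequentially"

definition stable_seq :: "(nat \<Rightarrow> real) \<Rightarrow> bool" where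
  "stable_seq \<alpha> \<longleftrightarrow> (\<exists>M. \<forall>n\<ge>1. \<alpha> (2 * n) \<le> M * \<alpha> n)"

section \<open>Power series spaces of infinite type\<close>

definition ps_norm :: "(nat \<Rightarrow> real) \<Rightarrow> nat \<Rightarrow> (nat \<Rightarrow> 'a::{real_normed_field, banach}) \<Rightarrow> real" where
  "ps_norm \<alpha> k x = (\<Sum>\<^sub>\<infinity>n\<in>{1..}. norm (x n) * exp (real k * \<alpha> n))"

definition ps_space :: "(nat \<Rightarrow> real) \<Rightarrow> (nat \<Rightarrow> 'a::{real_normed_field, banach}) set" where
  "ps_space \<alpha> =
     {x. x 0 = 0 \<and> (\<forall>k\<ge>1. (\<lambda>n. norm (x n) * exp (real k * \<alpha> n)) summable_on {1..})}"

definition ps_top :: "(nat \<Rightarrow> real) \<Rightarrow> (nat \<Rightarrow> 'a::{real_normed_field, banach}) topology" where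
  "ps_top \<alpha> = topology_generated_by
     {{y \<in> ps_space \<alpha>. ps_norm \<alpha> k (\<lambda>n. y n - x n) < \<epsilon>} | x k \<epsilon>.
        x \<in> ps_space \<alpha> \<and> 1 \<le> k \<and> 0 < \<epsilon>}"

text \<open>The sequence space with which the dual of \<open>ps_space \<alpha>\<close> is identified.\<close>

definition ps_dual :: "(nat \<Rightarrow> real) \<Rightarrow> (nat \<Rightarrow> 'a::{real_normed_field, banach}) set" where
  "ps_dual \<alpha> =
     {y. y 0 = 0 \<and> (\<exists>k\<ge>1. bdd_above ((\<lambda>n. norm (y n) * exp (- real k * \<alpha> n)) ` {1..}))}"

section \<open>Nuclearity\<close>

text \<open>
  Let \<open>E\<close> be a space of sequences with the increasing fundamental system of seminorms
  \<open>p 1, p 2, \<dots>\<close>. \<open>E\<close> is nuclear if for every \<open>k\<close> there is \<open>l \<ge> k\<close> such that the canonical map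
  from the local Banach space of \<open>p l\<close> to that of \<open>p k\<close> is nuclear, i.e. is a series
  \<open>\<Sum>i. f i \<otimes> y i\<close> with \<open>\<Sum>i. \<parallel>f i\<parallel> * p k (y i) < \<infinity>\<close>, where \<open>\<parallel>f i\<parallel>\<close> is the dual norm
  of \<open>p l\<close> (bounded by \<open>c i\<close> below). As \<open>E\<close> is dense in the local Banach space of \<open>p k\<close>, the
  vectors \<open>y i\<close> can be taken from \<open>E\<close>, and it is enough to have the series identity on \<open>E\<close>.
\<close>

definition nuclear_space ::
  "(nat \<Rightarrow> 'a::{real_normed_field, banach}) set \<Rightarrow> (nat \<Rightarrow> (nat \<Rightarrow> 'a) \<Rightarrow> real) \<Rightarrow> bool" where
  "nuclear_space E p \<longleftrightarrow>
     (\<forall>k\<ge>1. \<exists>l\<ge>k. \<exists>(f :: nat \<Rightarrow> (nat \<Rightarrow> 'a) \<Rightarrow> 'a) (c :: nat \<Rightarrow> real) (y :: nat \<Rightarrow> nat \<Rightarrow> 'a).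
        (\<forall>i. \<forall>x\<in>E. \<forall>z\<in>E. \<forall>s t. f i (\<lambda>n. s * x n + t * z n) = s * f i x + t * f i z) \<and>
        (\<forall>i. 0 \<le> c i \<and> (\<forall>x\<in>E. norm (f i x) \<le> c i * p l x)) \<and>
        (\<forall>i. y i \<in> E) \<and>
        summable (\<lambda>i. c i * p k (y i)) \<and>
        (\<forall>x\<in>E. (\<lambda>N. p k (\<lambda>n. x n - (\<Sum>i<N. f i x * y i n))) \<longlonglongrightarrow> 0))"

section \<open>Operators given by the images of the unit vectors\<close>

text \<open>
  \<open>c n\<close> is the image of the \<open>n\<close>-th unit vector, \<open>n \<ge> 1\<close>. The limit defining \<open>col_op\<close> is unique
  by \<open>ps_top_limit_unique\<close> below.
\<close>

definition col_partial_sum ::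
  "(nat \<Rightarrow> nat \<Rightarrow> 'a::{real_normed_field, banach}) \<Rightarrow> (nat \<Rightarrow> 'a) \<Rightarrow> nat \<Rightarrow> nat \<Rightarrow> 'a" where
  "col_partial_sum c x N = (\<lambda>i. \<Sum>n=1..N. x n * c n i)"

definition col_op_well_defined ::
  "(nat \<Rightarrow> real) \<Rightarrow> (nat \<Rightarrow> real) \<Rightarrow> (nat \<Rightarrow> nat \<Rightarrow> 'a::{real_normed_field, banach}) \<Rightarrow> bool" where
  "col_op_well_defined \<alpha> \<beta> c \<longleftrightarrow>
     (\<forall>n\<ge>1. c n \<in> ps_space \<beta>) \<and>
     (\<forall>x\<in>ps_space \<alpha>. \<exists>y. limitin (ps_top \<beta>) (col_partial_sum c x) y sequentially)"

definition col_op ::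
  "(nat \<Rightarrow> real) \<Rightarrow> (nat \<Rightarrow> nat \<Rightarrow> 'a::{real_normed_field, banach}) \<Rightarrow> (nat \<Rightarrow> 'a) \<Rightarrow> nat \<Rightarrow> 'a" where
  "col_op \<beta> c x = (THE y. limitin (ps_top \<beta>) (col_partial_sum c x) y sequentially)"

section \<open>Toeplitz operators\<close>

definition lower_col :: "(nat \<Rightarrow> 'a::zero) \<Rightarrow> nat \<Rightarrow> nat \<Rightarrow> 'a" where
  "lower_col \<eta> n = (\<lambda>j. if n \<le> j then \<eta> (j - n) else 0)"

definition upper_col :: "(nat \<Rightarrow> 'a::zero) \<Rightarrow> nat \<Rightarrow> nat \<Rightarrow> 'a" where
  "upper_col \<eta> n = (\<lambda>j. if 1 \<le> j \<and> j \<le> n then \<eta> (n - j) else 0)"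

text \<open>The one-sided sequence \<open>(\<eta>\<^sub>0, \<eta>\<^sub>1, \<dots>)\<close> as a sequence indexed by \<open>{1, 2, 3, \<dots>}\<close>.\<close>

definition as_seq :: "(nat \<Rightarrow> 'a::zero) \<Rightarrow> nat \<Rightarrow> 'a" where
  "as_seq \<eta> n = (if n = 0 then 0 else \<eta> (n - 1))"

text \<open>The two parts of a symbol \<open>\<theta>\<close> for a splitting \<open>\<theta> 0 = a + b\<close>.\<close>

definition hat_part :: "(int \<Rightarrow> 'a) \<Rightarrow> 'a \<Rightarrow> nat \<Rightarrow> 'a" where
  "hat_part \<theta> a j = (if j = 0 then a else \<theta> (int j))"

definition check_part :: "(int \<Rightarrow> 'a) \<Rightarrow> 'a \<Rightarrow> nat \<Rightarrow> 'a" where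
  "check_part \<theta> b j = (if j = 0 then b else \<theta> (- int j))"

definition toeplitz_well_defined ::
  "(nat \<Rightarrow> real) \<Rightarrow> (nat \<Rightarrow> real) \<Rightarrow> (int \<Rightarrow> 'a::{real_normed_field, banach}) \<Rightarrow> 'a \<Rightarrow> 'a \<Rightarrow> bool" where
  "toeplitz_well_defined \<alpha> \<beta> \<theta> a b \<longleftrightarrow>
     col_op_well_defined \<alpha> \<beta> (lower_col (hat_part \<theta> a)) \<and>
     col_op_well_defined \<alpha> \<beta> (upper_col (check_part \<theta> b))"

definition toeplitz_op ::
  "(nat \<Rightarrow> real) \<Rightarrow> (int \<Rightarrow> 'a::{real_normed_field, banach}) \<Rightarrow> 'a \<Rightarrow> 'a \<Rightarrow> (nat \<Rightarrow> 'a) \<Rightarrow> nat \<Rightarrow> 'a" where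
  "toeplitz_op \<beta> \<theta> a b x =
     (\<lambda>i. col_op \<beta> (lower_col (hat_part \<theta> a)) x i + col_op \<beta> (upper_col (check_part \<theta> b)) x i)"

lemma toeplitz_entry:
  fixes \<theta> :: "int \<Rightarrow> 'a::comm_monoid_add"
  assumes "1 \<le> i" "\<theta> 0 = a + b"
  shows "lower_col (hat_part \<theta> a) j i + upper_col (check_part \<theta> b) j i = \<theta> (int i - int j)"
proof -
  consider "i < j" | "i = j" | "j < i" by linarith
  then show ?thesis
    using assms
    by cases (auto simp: lower_col_def upper_col_def hat_part_def check_part_def of_nat_diff)
qed

section \<open>Consistency of the definitions\<close>

lemma openin_ps_ball:
  assumes "x \<in> ps_space \<alpha>" "1 \<le> k" "0 < \<epsilon>"
  shows "openin (ps_top \<alpha>) {y \<in> ps_space \<alpha>. ps_norm \<alpha> k (\<lambda>n. y n - x n) < \<epsilon>}"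
  unfolding ps_top_def
  by (rule topology_generated_by_Basis, rule CollectI, rule exI[of _ x], rule exI[of _ k],
      rule exI[of _ \<epsilon>]) (intro conjI refl assms)

lemma topspace_ps_top [simp]: "topspace (ps_top \<alpha>) = (ps_space \<alpha> :: (nat \<Rightarrow> 'a::{real_normed_field, banach}) set)"
proof
  show "topspace (ps_top \<alpha>) \<subseteq> (ps_space \<alpha> :: (nat \<Rightarrow> 'a) set)"
    unfolding ps_top_def topology_generated_by_topspace by (rule Union_least) auto
  show "(ps_space \<alpha> :: (nat \<Rightarrow> 'a) set) \<subseteq> topspace (ps_top \<alpha>)"
  proof
    fix x :: "nat \<Rightarrow> 'a"
    assume x: "x \<in> ps_space \<alpha>"
    have "ps_norm \<alpha> 1 (\<lambda>n. x n - x n) < 1"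
      by (simp add: ps_norm_def)
    with x have "x \<in> {y \<in> ps_space \<alpha>. ps_norm \<alpha> 1 (\<lambda>n. y n - x n) < 1}"
      by simp
    with openin_subset[OF openin_ps_ball[OF x order_refl zero_less_one]] show "x \<in> topspace (ps_top \<alpha>)"
      by (rule subsetD)
  qed
qed

lemma ps_space_add_scaled:
  assumes "x \<in> ps_space \<alpha>" "z \<in> ps_space \<alpha>"
  shows "(\<lambda>n. x n + t * z n) \<in> ps_space \<alpha>"
  unfolding ps_space_def
proof (intro CollectI conjI allI impI)
  show "x 0 + t * z 0 = 0"
    using assms by (simp add: ps_space_def)
  fix k :: nat
  assume k: "1 \<le> k"
  have "(\<lambda>n. norm (x n) * exp (real k * \<alpha> n) + norm t * (norm (z n) * exp (real k * \<alpha> n))) summable_on {1..}"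
    using assms k by (intro summable_on_add summable_on_cmult_right) (auto simp: ps_space_def)
  then show "(\<lambda>n. norm (x n + t * z n) * exp (real k * \<alpha> n)) summable_on {1..}"
  proof (rule summable_on_comparison_test)
    fix n :: nat
    show "norm (x n + t * z n) * exp (real k * \<alpha> n)
        \<le> norm (x n) * exp (real k * \<alpha> n) + norm t * (norm (z n) * exp (real k * \<alpha> n))"
      using mult_right_mono[OF norm_triangle_ineq[of "x n" "t * z n"], of "exp (real k * \<alpha> n)"]
      by (simp add: norm_mult algebra_simps)
  qed auto
qed

lemma ps_space_diff:
  assumes "x \<in> ps_space \<alpha>" "z \<in> ps_space \<alpha>"
  shows "(\<lambda>n. x n - z n) \<in> ps_space \<alpha>"
  using ps_space_add_scaled[OF assms, of "-1"] by simp

lemma ps_space_zero: "(\<lambda>n. 0) \<in> ps_space \<alpha>"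
  by (simp add: ps_space_def)

lemma ps_space_sum:
  assumes "\<And>i. y i \<in> ps_space \<alpha>"
  shows "(\<lambda>n. \<Sum>i<(N::nat). g i * y i n) \<in> ps_space \<alpha>"
proof (induction N)
  case (Suc N)
  then show ?case
    using ps_space_add_scaled[OF Suc assms, of "g N"] by simp
qed (simp add: ps_space_zero)

lemma sum_le_ps_norm:
  assumes "x \<in> ps_space \<alpha>" "1 \<le> k" "finite F" "F \<subseteq> {1..}"
  shows "(\<Sum>n\<in>F. norm (x n) * exp (real k * \<alpha> n)) \<le> ps_norm \<alpha> k x"
  unfolding ps_norm_def using assms by (intro finite_sum_le_infsum) (auto simp: ps_space_def)

lemma coord_le_ps_norm:
  assumes "x \<in> ps_space \<alpha>" "1 \<le> k" "1 \<le> n"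
  shows "norm (x n) * exp (real k * \<alpha> n) \<le> ps_norm \<alpha> k x"
  using sum_le_ps_norm[of x \<alpha> k "{n}"] assms by simp

lemma ps_top_limit_unique:
  fixes s :: "nat \<Rightarrow> nat \<Rightarrow> 'a::{real_normed_field, banach}"
  assumes "limitin (ps_top \<alpha>) s y sequentially" "limitin (ps_top \<alpha>) s z sequentially"
  shows "y = z"
proof
  fix n
  have coord: "(\<lambda>N. s N n) \<longlonglongrightarrow> w n"
    if lim: "limitin (ps_top \<alpha>) s w sequentially" and n: "1 \<le> n" for w
  proof (rule tendstoI)
    fix e :: real
    assume e: "0 < e"
    let ?d = "e * exp (real 1 * \<alpha> n)"
    let ?U = "{v \<in> ps_space \<alpha>. ps_norm \<alpha> 1 (\<lambda>n. v n - w n) < ?d}"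
    have w: "w \<in> ps_space \<alpha>"
      using lim by (simp add: limitin_def)
    have "openin (ps_top \<alpha>) ?U"
      using w e by (intro openin_ps_ball) auto
    moreover have "w \<in> ?U"
      using w e by (simp add: ps_norm_def)
    ultimately have "\<forall>\<^sub>F N in sequentially. s N \<in> ?U"
      using lim unfolding limitin_def by blast
    then show "\<forall>\<^sub>F N in sequentially. dist (s N n) (w n) < e"
    proof eventually_elim
      case (elim N)
      then have "norm (s N n - w n) * exp (real 1 * \<alpha> n) < ?d"
        using coord_le_ps_norm[OF ps_space_diff[OF _ w], of "s N" 1 n] n
        by (intro le_less_trans[of "norm (s N n - w n) * exp (real 1 * \<alpha> n)"]) auto
      then show ?case
        by (simp add: dist_norm)
    qed
  qed
  show "y n = z n"
  proof (cases "n = 0")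
    case True
    then show ?thesis
      using assms by (auto simp: limitin_def ps_space_def)
  next
    case False
    then have "1 \<le> n" by simp
    from LIMSEQ_unique[OF coord[OF assms(1) this] coord[OF assms(2) this]] show ?thesis .
  qed
qed

lemma ps_norm_unit:
  fixes n k :: nat
  assumes "1 \<le> n"
  defines "e \<equiv> (\<lambda>m. if m = n then 1 else 0 :: 'a::{real_normed_field, banach})"
  shows "e \<in> ps_space \<alpha>" "ps_norm \<alpha> k e = exp (real k * \<alpha> n)"
proof -
  have "((\<lambda>m. norm (e m) * exp (real k * \<alpha> m)) has_sum exp (real k * \<alpha> n)) {1..}" for k :: nat
  proof -
    have "((\<lambda>m. norm (e m) * exp (real k * \<alpha> m)) has_sum exp (real k * \<alpha> n)) {n}"
      by (rule has_sum_finiteI) (auto simp: e_def)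
    moreover have "((\<lambda>m. norm (e m) * exp (real k * \<alpha> m)) has_sum exp (real k * \<alpha> n)) {n} \<longleftrightarrow>
        ((\<lambda>m. norm (e m) * exp (real k * \<alpha> m)) has_sum exp (real k * \<alpha> n)) {1..}"
      by (rule has_sum_cong_neutral) (use assms(1) in \<open>auto simp: e_def\<close>)
    ultimately show ?thesis
      by simp
  qed
  note hs = this
  show "e \<in> ps_space \<alpha>"
    unfolding ps_space_def
  proof (intro CollectI conjI allI impI)
    show "e 0 = 0"
      using assms(1) by (simp add: e_def)
  qed (rule has_sum_imp_summable[OF hs])
  show "ps_norm \<alpha> k e = exp (real k * \<alpha> n)"
    unfolding ps_norm_def by (rule infsumI) (rule hs)
qed

text \<open>The Grothendieck--Pietsch criterion.\<close>

theorem nuclear_ps_space_iff: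
  assumes \<alpha>: "exponent_seq \<alpha>"
  shows "nuclear_space (ps_space \<alpha> :: (nat \<Rightarrow> 'a::{real_normed_field, banach}) set) (ps_norm \<alpha>) \<longleftrightarrow>
    (\<forall>k\<ge>1. \<exists>l>k. (\<lambda>n. exp ((real k - real l) * \<alpha> n)) summable_on {1..})"
    (is "?L \<longleftrightarrow> ?R")
proof
  assume ?L
  show ?R
  proof (intro allI impI)
    fix k :: nat
    assume k: "1 \<le> k"
    obtain l and f :: "nat \<Rightarrow> (nat \<Rightarrow> 'a) \<Rightarrow> 'a" and c and y :: "nat \<Rightarrow> nat \<Rightarrow> 'a"
      where l: "k \<le> l"
        and "\<forall>i. \<forall>x\<in>ps_space \<alpha>. \<forall>z\<in>ps_space \<alpha>. \<forall>s t.
          f i (\<lambda>n. s * x n + t * z n) = s * f i x + t * f i z"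
        and cf: "\<forall>i. 0 \<le> c i \<and> (\<forall>x\<in>ps_space \<alpha>. norm (f i x) \<le> c i * ps_norm \<alpha> l x)"
        and y': "\<forall>i. y i \<in> ps_space \<alpha>"
        and sm: "summable (\<lambda>i. c i * ps_norm \<alpha> k (y i))"
        and lim': "\<forall>x\<in>ps_space \<alpha>.
          (\<lambda>N. ps_norm \<alpha> k (\<lambda>n. x n - (\<Sum>i<N. f i x * y i n))) \<longlonglongrightarrow> 0"
      using \<open>?L\<close>[unfolded nuclear_space_def, THEN spec, THEN mp, OF k]
      by (elim exE conjE) (rule that)
    note y = y'[rule_format] and lim = lim'[rule_format]
    from cf have c: "0 \<le> c i" for i
      by simp
    from cf have f: "norm (f i x) \<le> c i * ps_norm \<alpha> l x" if "x \<in> ps_space \<alpha>" for i x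
      using that by simp
    define e where "e n = (\<lambda>m. if m = n then 1 else 0 :: 'a)" for n :: nat
    define S where "S = (\<Sum>i. c i * ps_norm \<alpha> k (y i))"
    have pn: "0 \<le> ps_norm \<alpha> k (y i)" for i
      unfolding ps_norm_def by (rule infsum_nonneg) auto
    have conv: "(\<lambda>N. \<Sum>i<N. f i (e n) * y i n) \<longlonglongrightarrow> 1" if n: "1 \<le> n" for n
    proof -
      have en: "e n \<in> ps_space \<alpha>"
        unfolding e_def by (rule ps_norm_unit(1)[OF n])
      have sumE: "(\<lambda>m. \<Sum>i<N. f i (e n) * y i m) \<in> ps_space \<alpha>" for N
        by (rule ps_space_sum) (rule y)
      let ?z = "\<lambda>N m. e n m - (\<Sum>i<N. f i (e n) * y i m)"
      have "norm (?z N n) \<le> ps_norm \<alpha> k (?z N) * exp (- (real k * \<alpha> n))" for N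
        using coord_le_ps_norm[OF ps_space_diff[OF en sumE[of N]] k n]
        by (simp only: exp_minus divide_inverse[symmetric] pos_le_divide_eq[OF exp_gt_zero])
      then have "\<forall>\<^sub>F N in sequentially. norm (?z N n) \<le> ps_norm \<alpha> k (?z N) * exp (- (real k * \<alpha> n))"
        by simp
      moreover have "(\<lambda>N. ps_norm \<alpha> k (?z N) * exp (- (real k * \<alpha> n))) \<longlonglongrightarrow> 0"
        by (rule tendsto_mult_left_zero[OF lim[OF en]])
      ultimately have null: "(\<lambda>N. ?z N n) \<longlonglongrightarrow> 0"
        by (rule Lim_null_comparison)
      have "e n n = 1"
        by (simp add: e_def)
      moreover have "(\<lambda>N. e n n - ?z N n) \<longlonglongrightarrow> e n n - 0"
        by (rule tendsto_diff[OF tendsto_const null])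
      ultimately show ?thesis
        by (simp only: diff_diff_eq2 add_diff_cancel_left' diff_zero)
    qed
    have bound: "(\<Sum>n\<in>F. exp ((real k - real l) * \<alpha> n)) \<le> S" if F: "finite F" "F \<subseteq> {1..}" for F
    proof (rule LIMSEQ_le_const2)
      show "(\<lambda>N. \<Sum>n\<in>F. exp ((real k - real l) * \<alpha> n) * norm (\<Sum>i<N. f i (e n) * y i n))
        \<longlonglongrightarrow> (\<Sum>n\<in>F. exp ((real k - real l) * \<alpha> n))"
      proof (rule tendsto_sum)
        fix n
        assume "n \<in> F"
        with F have "1 \<le> n" by auto
        from tendsto_mult_left[OF tendsto_norm[OF conv[OF this]], of "exp ((real k - real l) * \<alpha> n)"]
        show "(\<lambda>N. exp ((real k - real l) * \<alpha> n) * norm (\<Sum>i<N. f i (e n) * y i n))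
          \<longlonglongrightarrow> exp ((real k - real l) * \<alpha> n)"
          by simp
      qed
      have "(\<Sum>n\<in>F. exp ((real k - real l) * \<alpha> n) * norm (\<Sum>i<N. f i (e n) * y i n)) \<le> S" for N
      proof -
        have "exp ((real k - real l) * \<alpha> n) * norm (\<Sum>i<N. f i (e n) * y i n)
            \<le> (\<Sum>i<N. c i * (norm (y i n) * exp (real k * \<alpha> n)))" if "n \<in> F" for n
        proof -
          have n: "1 \<le> n" using F that by auto
          have fe: "norm (f i (e n)) \<le> c i * exp (real l * \<alpha> n)" for i
            using f[of "e n" i] ps_norm_unit[OF n, of \<alpha>, where 'a = 'a] unfolding e_def by simp
          have "norm (\<Sum>i<N. f i (e n) * y i n) \<le> (\<Sum>i<N. c i * exp (real l * \<alpha> n) * norm (y i n))"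
            by (rule sum_norm_le) (simp add: norm_mult mult_right_mono[OF fe])
          then have "exp ((real k - real l) * \<alpha> n) * norm (\<Sum>i<N. f i (e n) * y i n)
            \<le> exp ((real k - real l) * \<alpha> n) * (\<Sum>i<N. c i * exp (real l * \<alpha> n) * norm (y i n))"
            by (rule mult_left_mono) simp
          also have "\<dots> = (\<Sum>i<N. c i * (norm (y i n) * exp (real k * \<alpha> n)))"
          proof -
            have "exp (real k * \<alpha> n) = exp ((real k - real l) * \<alpha> n) * exp (real l * \<alpha> n)"
              by (simp add: exp_add[symmetric] left_diff_distrib)
            then show ?thesis
              by (simp only: sum_distrib_left mult_ac)
          qed
          finally show ?thesis .
        qed
        then have "(\<Sum>n\<in>F. exp ((real k - real l) * \<alpha> n) * norm (\<Sum>i<N. f i (e n) * y i n))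
            \<le> (\<Sum>n\<in>F. \<Sum>i<N. c i * (norm (y i n) * exp (real k * \<alpha> n)))"
          by (rule sum_mono)
        also have "\<dots> = (\<Sum>i<N. c i * (\<Sum>n\<in>F. norm (y i n) * exp (real k * \<alpha> n)))"
          by (subst sum.swap) (simp add: sum_distrib_left)
        also have "\<dots> \<le> (\<Sum>i<N. c i * ps_norm \<alpha> k (y i))"
          by (intro sum_mono mult_left_mono sum_le_ps_norm y k F c)
        also have "\<dots> \<le> S"
          unfolding S_def by (rule sum_le_suminf[OF sm]) (use c pn in auto)
        finally show ?thesis .
      qed
      then show "\<exists>N. \<forall>m\<ge>N. (\<Sum>n\<in>F. exp ((real k - real l) * \<alpha> n) *
          norm (\<Sum>i<m. f i (e n) * y i n)) \<le> S"
        by blast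
    qed
    have "(\<lambda>n. exp ((real k - real l) * \<alpha> n)) summable_on {1..}"
      by (rule nonneg_bdd_above_summable_on) (auto intro!: bdd_aboveI2[of _ _ S] bound)
    then have "(\<lambda>n. exp ((real k - real (Suc l)) * \<alpha> n)) summable_on {1..}"
    proof (rule summable_on_comparison_test)
      fix n :: nat
      assume "n \<in> {1..}"
      then have "0 \<le> \<alpha> n" using \<alpha> by (auto simp: exponent_seq_def)
      then show "exp ((real k - real (Suc l)) * \<alpha> n) \<le> exp ((real k - real l) * \<alpha> n)"
        by (simp add: algebra_simps)
    qed auto
    then show "\<exists>l>k. (\<lambda>n. exp ((real k - real l) * \<alpha> n)) summable_on {1..}"
      using l by (intro exI[of _ "Suc l"]) auto
  qed
next
  assume R: ?R
  show ?L
    unfolding nuclear_space_def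
  proof (intro allI impI)
    fix k :: nat
    assume k: "1 \<le> k"
    with R obtain l where l: "k < l"
      and sm: "(\<lambda>n. exp ((real k - real l) * \<alpha> n)) summable_on {1..}"
      by blast
    define f where "f i x = x (Suc i)" for i and x :: "nat \<Rightarrow> 'a"
    define c where "c i = exp (- (real l * \<alpha> (Suc i)))" for i
    define y where "y i = (\<lambda>m. if m = Suc i then 1 else 0 :: 'a)" for i
    have y: "y i \<in> ps_space \<alpha>" "ps_norm \<alpha> k (y i) = exp (real k * \<alpha> (Suc i))" for i
      unfolding y_def by (rule ps_norm_unit; simp)+
    have 1: "norm (f i x) \<le> c i * ps_norm \<alpha> l x" if "x \<in> ps_space \<alpha>" for i x
      using coord_le_ps_norm[OF that, of l "Suc i"] k l
      by (simp add: f_def c_def exp_minus field_simps)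
    have "bij_betw Suc UNIV {1..}"
      by (rule bij_betwI[where g = "\<lambda>n. n - 1"]) auto
    then have "(\<lambda>i. exp ((real k - real l) * \<alpha> (Suc i))) summable_on UNIV"
      using sm by (subst summable_on_reindex_bij_betw) auto
    then have "summable (\<lambda>i. exp ((real k - real l) * \<alpha> (Suc i)))"
      by (subst (asm) summable_on_UNIV_nonneg_real_iff) auto
    moreover have "c i * ps_norm \<alpha> k (y i) = exp ((real k - real l) * \<alpha> (Suc i))" for i
      by (simp add: c_def y exp_add[symmetric] left_diff_distrib)
    ultimately have 2: "summable (\<lambda>i. c i * ps_norm \<alpha> k (y i))"
      by simp
    have 3: "(\<lambda>N. ps_norm \<alpha> k (\<lambda>n. x n - (\<Sum>i<N. f i x * y i n))) \<longlonglongrightarrow> 0"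
      if x: "x \<in> ps_space \<alpha>" for x
    proof -
      let ?g = "\<lambda>n. norm (x n) * exp (real k * \<alpha> n)"
      have g: "?g summable_on {1..}"
        using x k by (simp add: ps_space_def)
      have "ps_norm \<alpha> k (\<lambda>n. x n - (\<Sum>i<N. f i x * y i n)) = infsum ?g {1..} - (\<Sum>n<N. ?g (Suc n))"
        for N
      proof -
        have part: "(\<Sum>i<N. f i x * y i n) = (if n \<le> N then x n else 0)" if "1 \<le> n" for n
        proof -
          have "(\<Sum>i<N. f i x * y i n) = (\<Sum>i<N. if i = n - 1 then x n else 0)"
            using that by (intro sum.cong) (auto simp: f_def y_def)
          then show ?thesis using that by (auto simp: sum.delta)
        qed
        have "ps_norm \<alpha> k (\<lambda>n. x n - (\<Sum>i<N. f i x * y i n)) = infsum ?g ({1..} - {1..N})"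
          unfolding ps_norm_def by (rule infsum_cong_neutral) (auto simp: part)
        also have "\<dots> = infsum ?g {1..} - infsum ?g {1..N}"
          by (rule infsum_Diff) (use g in auto)
        also have "infsum ?g {1..N} = (\<Sum>n<N. ?g (Suc n))"
          by (simp add: sum.atLeast1_atMost_eq)
        finally show ?thesis .
      qed
      moreover have "(\<lambda>N. \<Sum>n<N. ?g (Suc n)) \<longlonglongrightarrow> infsum ?g {1..}"
      proof -
        have "((\<lambda>n. ?g (Suc n)) has_sum infsum ?g {1..}) UNIV"
          using has_sum_infsum[OF g] \<open>bij_betw Suc UNIV {1..}\<close>
          by (subst has_sum_reindex_bij_betw[where g = Suc]) auto
        then show ?thesis
          using has_sum_imp_sums unfolding sums_def by blast
      qed
      ultimately show ?thesis
        using tendsto_diff[OF tendsto_const[of "infsum ?g {1..}"]] by force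
    qed
    show "\<exists>l\<ge>k. \<exists>(f :: nat \<Rightarrow> (nat \<Rightarrow> 'a) \<Rightarrow> 'a) c y.
        (\<forall>i. \<forall>x\<in>ps_space \<alpha>. \<forall>z\<in>ps_space \<alpha>. \<forall>s t.
           f i (\<lambda>n. s * x n + t * z n) = s * f i x + t * f i z) \<and>
        (\<forall>i. 0 \<le> c i \<and> (\<forall>x\<in>ps_space \<alpha>. norm (f i x) \<le> c i * ps_norm \<alpha> l x)) \<and>
        (\<forall>i. y i \<in> ps_space \<alpha>) \<and>
        summable (\<lambda>i. c i * ps_norm \<alpha> k (y i)) \<and>
        (\<forall>x\<in>ps_space \<alpha>. (\<lambda>N. ps_norm \<alpha> k (\<lambda>n. x n - (\<Sum>i<N. f i x * y i n))) \<longlonglongrightarrow> 0)"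
      using l 1 2 3 y(1)
      by (intro exI[of _ l] exI[of _ f] exI[of _ c] exI[of _ y] conjI) (auto simp: f_def c_def)
  qed
qed

end

theory Submission
  imports Defs
begin

text \<open>
  An operator given by columns \<open>c n\<close> is controlled by the growth of its columns. If for every \<open>k\<close>
  there are \<open>l\<close> and \<open>D\<close> with \<open>\<parallel>c n\<parallel>\<^sub>k \<le> D * exp (l * \<alpha> n)\<close> for all \<open>n\<close> (\<open>col_bounded\<close>), then
  \<open>\<Sum>n. \<bar>x n\<bar> * \<parallel>c n\<parallel>\<^sub>k \<le> D * \<parallel>x\<parallel>\<^sub>l\<close>, so the series \<open>\<Sum>n. x n * c n\<close> converges absolutely in
  every seminorm of \<open>ps_space \<beta>\<close>, and its sum depends continuously on \<open>x\<close>
  (\<open>limitin_col_sum\<close>, \<open>continuous_map_col_sum\<close>). It remains to estimate the columns of the two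
  triangular parts of the Toeplitz matrix. Both estimates use that \<open>exp (k * \<beta> n)\<close> is dominated by
  some \<open>C * exp (m * \<alpha> n)\<close>.

  The \<open>j\<close>-th entry of the \<open>n\<close>-th column of the lower triangular part is \<open>\<eta> (j - n)\<close>, the
  coordinate with number \<open>i = j - n + 1\<close> of the symbol. Since \<open>j \<le> 2 * max n i\<close>, stability gives
  \<open>\<beta> j \<le> M * (\<beta> n + \<beta> i)\<close>. Thus the weight \<open>exp (k * \<beta> j)\<close> splits into a factor in \<open>i\<close>, which
  is absorbed by the symbol because the latter lies in \<open>ps_space \<beta>\<close>, and the factor
  \<open>exp (k * M * \<beta> n)\<close>, which is dominated by \<open>\<alpha>\<close> (\<open>col_bounded_lower_col\<close>).

  A column of the upper triangular part has only \<open>n\<close> non-zero entries. By monotonicity each of them,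
  multiplied by its weight, is at most a constant times \<open>exp ((p + m) * \<alpha> n)\<close>, where \<open>p\<close>
  comes from the symbol being in the dual. The number \<open>n\<close> of entries is harmless by nuclearity,
  which implies \<open>n \<le> D * exp (q * \<alpha> n)\<close> (\<open>col_bounded_upper_col\<close>, \<open>nuclear_imp_index_le_exp\<close>).
\<close>

section \<open>Seminorms and topology of power series spaces\<close>

lemma has_sum_sum_finite:
  fixes f :: "'i \<Rightarrow> 'b \<Rightarrow> 'c::topological_comm_monoid_add"
  assumes "finite F" "\<And>i. i \<in> F \<Longrightarrow> (f i has_sum s i) A"
  shows "((\<lambda>n. \<Sum>i\<in>F. f i n) has_sum (\<Sum>i\<in>F. s i)) A"
  using assms by (induction F rule: finite_induct) (auto intro!: has_sum_add)

lemma ps_norm_nonneg: "0 \<le> ps_norm \<alpha> k x"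
  unfolding ps_norm_def by (rule infsum_nonneg) auto

lemma ps_norm_minus_commute: "ps_norm \<alpha> k (\<lambda>n. x n - y n) = ps_norm \<alpha> k (\<lambda>n. y n - x n)"
  unfolding ps_norm_def by (simp add: norm_minus_commute)

lemma ps_norm_add:
  assumes "x \<in> ps_space \<alpha>" "y \<in> ps_space \<alpha>" "1 \<le> k"
  shows "ps_norm \<alpha> k (\<lambda>n. x n + y n) \<le> ps_norm \<alpha> k x + ps_norm \<alpha> k y"
proof -
  have s: "(\<lambda>n. norm (z n) * exp (real k * \<alpha> n)) summable_on {1..}"
    if "z \<in> ps_space \<alpha>" for z :: "nat \<Rightarrow> 'a"
    using that assms(3) by (simp add: ps_space_def)
  have "(\<lambda>n. x n + y n) \<in> ps_space \<alpha>"
    using ps_space_add_scaled[OF assms(1,2), of 1] by simp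
  then have "ps_norm \<alpha> k (\<lambda>n. x n + y n)
      \<le> (\<Sum>\<^sub>\<infinity>n\<in>{1..}. norm (x n) * exp (real k * \<alpha> n) + norm (y n) * exp (real k * \<alpha> n))"
    unfolding ps_norm_def
    by (intro infsum_mono s summable_on_add assms)
      (auto simp: distrib_right[symmetric] norm_triangle_ineq)
  also have "\<dots> = ps_norm \<alpha> k x + ps_norm \<alpha> k y"
    unfolding ps_norm_def by (intro infsum_add s assms)
  finally show ?thesis .
qed

lemma ps_norm_triangle:
  assumes "x \<in> ps_space \<alpha>" "y \<in> ps_space \<alpha>" "z \<in> ps_space \<alpha>" "1 \<le> k"
  shows "ps_norm \<alpha> k (\<lambda>n. x n - z n)
    \<le> ps_norm \<alpha> k (\<lambda>n. x n - y n) + ps_norm \<alpha> k (\<lambda>n. y n - z n)"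
  using ps_norm_add[OF ps_space_diff[OF assms(1,2)] ps_space_diff[OF assms(2,3)] assms(4)] by simp

lemma ps_norm_le_has_sum:
  assumes "\<And>j. 1 \<le> j \<Longrightarrow> norm (x j) * exp (real k * \<beta> j) \<le> g j" "(g has_sum S) {1..}"
  shows "(\<lambda>j. norm (x j) * exp (real k * \<beta> j)) summable_on {1..}" "ps_norm \<beta> k x \<le> S"
proof -
  show s: "(\<lambda>j. norm (x j) * exp (real k * \<beta> j)) summable_on {1..}"
    using has_sum_imp_summable[OF assms(2)]
    by (rule summable_on_comparison_test) (use assms(1) in auto)
  have "ps_norm \<beta> k x \<le> infsum g {1..}"
    unfolding ps_norm_def
    by (rule infsum_mono[OF s has_sum_imp_summable[OF assms(2)]]) (use assms(1) in auto)
  then show "ps_norm \<beta> k x \<le> S"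
    using infsumI[OF assms(2)] by simp
qed

text \<open>
  The topology is generated by the seminorm balls around all centres, so a sequence has to be followed
  into balls that are not centred at its limit; the triangle inequality reduces them to centred ones.
\<close>

lemma limitin_ps_topI:
  assumes y: "y \<in> ps_space \<beta>" and s: "\<And>N. s N \<in> ps_space \<beta>"
    and lim: "\<And>k. 1 \<le> k \<Longrightarrow> (\<lambda>N. ps_norm \<beta> k (\<lambda>n. s N n - y n)) \<longlonglongrightarrow> 0"
  shows "limitin (ps_top \<beta>) s y sequentially"
  unfolding limitin_def
proof (intro conjI allI impI)
  show "y \<in> topspace (ps_top \<beta>)"
    using y by simp
  fix U
  assume "openin (ps_top \<beta>) U \<and> y \<in> U"
  then have "generate_topology_on
      {{y \<in> ps_space \<beta>. ps_norm \<beta> k (\<lambda>n. y n - x n) < \<epsilon>} | x k \<epsilon>.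
        x \<in> ps_space \<beta> \<and> 1 \<le> k \<and> 0 < \<epsilon>} U" and "y \<in> U"
    unfolding ps_top_def by (auto dest: openin_topology_generated_by)
  then show "\<forall>\<^sub>F N in sequentially. s N \<in> U"
  proof (induction U rule: generate_topology_on.induct)
    case (Int a b)
    then show ?case
      by (auto intro: eventually_conj)
  next
    case (UN K)
    then obtain V where "V \<in> K" "\<forall>\<^sub>F N in sequentially. s N \<in> V"
      by auto
    then show ?case
      by (auto elim!: eventually_mono)
  next
    case (Basis U)
    then obtain x k \<epsilon> where x: "x \<in> ps_space \<beta>" and k: "1 \<le> k"
      and U: "U = {y \<in> ps_space \<beta>. ps_norm \<beta> k (\<lambda>n. y n - x n) < \<epsilon>}"
      by auto
    have "0 < \<epsilon> - ps_norm \<beta> k (\<lambda>n. y n - x n)"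
      using \<open>y \<in> U\<close> U by simp
    from order_tendstoD(2)[OF lim[OF k] this] show ?case
    proof eventually_elim
      case (elim N)
      with ps_norm_triangle[OF s[of N] y x k] s[of N] show ?case
        by (simp add: U)
    qed
  qed simp
qed

lemma continuous_map_ps_topI:
  assumes T: "\<And>v. v \<in> ps_space \<alpha> \<Longrightarrow> T v \<in> ps_space \<beta>"
    and lip: "\<And>k. 1 \<le> k \<Longrightarrow> \<exists>l\<ge>1. \<exists>D\<ge>0. \<forall>v\<in>ps_space \<alpha>. \<forall>w\<in>ps_space \<alpha>.
      ps_norm \<beta> k (\<lambda>n. T v n - T w n) \<le> D * ps_norm \<alpha> l (\<lambda>n. v n - w n)"
  shows "continuous_map (ps_top \<alpha>) (ps_top \<beta>) T"
proof -
  have "openin (ps_top \<alpha>)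
      (T -` {y \<in> ps_space \<beta>. ps_norm \<beta> k (\<lambda>n. y n - x n) < \<epsilon>} \<inter> topspace (ps_top \<alpha>))"
    (is "openin _ ?W")
    if x: "x \<in> ps_space \<beta>" and k: "1 \<le> k" for x k \<epsilon>
  proof (subst openin_subopen, intro ballI)
    fix v
    assume v: "v \<in> ?W"
    then have v': "v \<in> ps_space \<alpha>"
      by simp
    obtain l D where l: "1 \<le> l" and D: "0 \<le> D"
      and lD: "\<And>v w. v \<in> ps_space \<alpha> \<Longrightarrow> w \<in> ps_space \<alpha> \<Longrightarrow>
        ps_norm \<beta> k (\<lambda>n. T v n - T w n) \<le> D * ps_norm \<alpha> l (\<lambda>n. v n - w n)"
      using lip[OF k] by blast
    define r where "r = \<epsilon> - ps_norm \<beta> k (\<lambda>n. T v n - x n)"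
    \<comment> \<open>\<open>D + 1\<close> instead of \<open>D\<close> avoids a separate case \<open>D = 0\<close>.\<close>
    define \<delta> where "\<delta> = r / (D + 1)"
    have r: "0 < r"
      using v by (simp add: r_def)
    then have \<delta>: "0 < \<delta>"
      using D by (simp add: \<delta>_def)
    let ?B = "{w \<in> ps_space \<alpha>. ps_norm \<alpha> l (\<lambda>n. w n - v n) < \<delta>}"
    have "openin (ps_top \<alpha>) ?B"
      by (rule openin_ps_ball[OF v' l \<delta>])
    moreover have "v \<in> ?B"
      using v' \<delta> by (simp add: ps_norm_def)
    moreover have "?B \<subseteq> ?W"
    proof
      fix w
      assume "w \<in> ?B"
      then have w: "w \<in> ps_space \<alpha>" and less: "ps_norm \<alpha> l (\<lambda>n. w n - v n) < \<delta>"
        by auto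
      have "ps_norm \<beta> k (\<lambda>n. T w n - T v n) \<le> D * ps_norm \<alpha> l (\<lambda>n. w n - v n)"
        by (rule lD[OF w v'])
      also have "\<dots> \<le> D * \<delta>"
        using less D by (intro mult_left_mono) auto
      also have "\<dots> < (D + 1) * \<delta>"
        using \<delta> by (simp add: distrib_right)
      also have "\<dots> = r"
        using D by (simp add: \<delta>_def)
      finally have "ps_norm \<beta> k (\<lambda>n. T w n - x n) < \<epsilon>"
        using ps_norm_triangle[OF T[OF w] T[OF v'] x k] by (simp add: r_def)
      with T[OF w] w show "w \<in> ?W"
        by simp
    qed
    ultimately show "\<exists>B. openin (ps_top \<alpha>) B \<and> v \<in> B \<and> B \<subseteq> ?W"
      by blast
  qed
  moreover have "T ` topspace (ps_top \<alpha>) \<subseteq> topspace (ps_top \<beta>)"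
    using T by auto
  ultimately show ?thesis
    unfolding ps_top_def[of \<beta>] continuous_on_generated_topo_iff topology_generated_by_topspace
    by (auto simp del: topspace_ps_top)
qed

section \<open>Operators with bounded columns\<close>

definition col_bounded ::
  "(nat \<Rightarrow> real) \<Rightarrow> (nat \<Rightarrow> real) \<Rightarrow> (nat \<Rightarrow> nat \<Rightarrow> 'a::{real_normed_field, banach}) \<Rightarrow> bool" where
  "col_bounded \<alpha> \<beta> c \<longleftrightarrow>
     (\<forall>n\<ge>1. c n \<in> ps_space \<beta>) \<and>
     (\<forall>k\<ge>1. \<exists>l\<ge>1. \<exists>D\<ge>0. \<forall>n\<ge>1. ps_norm \<beta> k (c n) \<le> D * exp (real l * \<alpha> n))"

definition col_sum ::
  "(nat \<Rightarrow> nat \<Rightarrow> 'a::{real_normed_field, banach}) \<Rightarrow> (nat \<Rightarrow> 'a) \<Rightarrow> nat \<Rightarrow> 'a" where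
  "col_sum c x = (\<lambda>i. \<Sum>\<^sub>\<infinity>n\<in>{1..}. x n * c n i)"

lemma col_boundedI:
  assumes "\<And>n. 1 \<le> n \<Longrightarrow> c n 0 = 0"
    and "\<And>k. 1 \<le> k \<Longrightarrow> \<exists>l\<ge>1. \<exists>D\<ge>0. \<forall>n\<ge>1. \<exists>g S. (g has_sum S) {1..} \<and>
      (\<forall>j\<ge>1. norm (c n j) * exp (real k * \<beta> j) \<le> g j) \<and> S \<le> D * exp (real l * \<alpha> n)"
  shows "col_bounded \<alpha> \<beta> c"
  unfolding col_bounded_def
proof (intro conjI allI impI)
  fix n :: nat
  assume n: "1 \<le> n"
  show "c n \<in> ps_space \<beta>"
    unfolding ps_space_def
  proof (intro CollectI conjI allI impI)
    fix k :: nat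
    assume "1 \<le> k"
    from assms(2)[OF this] n obtain g S where "(g has_sum S) {1..}"
      "\<And>j. 1 \<le> j \<Longrightarrow> norm (c n j) * exp (real k * \<beta> j) \<le> g j"
      by meson
    from ps_norm_le_has_sum(1)[OF this(2,1)]
    show "(\<lambda>j. norm (c n j) * exp (real k * \<beta> j)) summable_on {1..}" .
  qed (rule assms(1)[OF n])
next
  fix k :: nat
  assume "1 \<le> k"
  from assms(2)[OF this] obtain l D where l: "1 \<le> l" "0 \<le> D"
    and *: "\<forall>n\<ge>1. \<exists>g S. (g has_sum S) {1..} \<and>
      (\<forall>j\<ge>1. norm (c n j) * exp (real k * \<beta> j) \<le> g j) \<and> S \<le> D * exp (real l * \<alpha> n)"
    by blast
  have "ps_norm \<beta> k (c n) \<le> D * exp (real l * \<alpha> n)" if n: "1 \<le> n" for n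
  proof -
    obtain g S where g: "(g has_sum S) {1..}"
      "\<And>j. 1 \<le> j \<Longrightarrow> norm (c n j) * exp (real k * \<beta> j) \<le> g j"
      and S: "S \<le> D * exp (real l * \<alpha> n)"
      using * n by meson
    from ps_norm_le_has_sum(2)[OF g(2,1)] S show ?thesis
      by simp
  qed
  with l show "\<exists>l\<ge>1. \<exists>D\<ge>0. \<forall>n\<ge>1. ps_norm \<beta> k (c n) \<le> D * exp (real l * \<alpha> n)"
    by blast
qed

lemma col_bounded_add:
  assumes \<alpha>: "exponent_seq \<alpha>" and c: "col_bounded \<alpha> \<beta> c" and d: "col_bounded \<alpha> \<beta> d"
  shows "col_bounded \<alpha> \<beta> (\<lambda>n i. c n i + d n i)"
  unfolding col_bounded_def
proof (intro conjI allI impI)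
  fix n :: nat
  assume "1 \<le> n"
  then show "(\<lambda>i. c n i + d n i) \<in> ps_space \<beta>"
    using c d ps_space_add_scaled[of "c n" \<beta> "d n" 1] by (simp add: col_bounded_def)
next
  fix k :: nat
  assume k: "1 \<le> k"
  obtain l D where l: "1 \<le> l" "0 \<le> D"
    and lD: "\<And>n. 1 \<le> n \<Longrightarrow> ps_norm \<beta> k (c n) \<le> D * exp (real l * \<alpha> n)"
    using c k unfolding col_bounded_def by meson
  obtain l' D' where l': "1 \<le> l'" "0 \<le> D'"
    and lD': "\<And>n. 1 \<le> n \<Longrightarrow> ps_norm \<beta> k (d n) \<le> D' * exp (real l' * \<alpha> n)"
    using d k unfolding col_bounded_def by meson
  have "ps_norm \<beta> k (\<lambda>i. c n i + d n i) \<le> (D + D') * exp (real (l + l') * \<alpha> n)"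
    if n: "1 \<le> n" for n
  proof -
    have "0 \<le> \<alpha> n"
      using \<alpha> n by (simp add: exponent_seq_def)
    then have "exp (real l * \<alpha> n) \<le> exp (real (l + l') * \<alpha> n)"
      "exp (real l' * \<alpha> n) \<le> exp (real (l + l') * \<alpha> n)"
      by (simp_all add: algebra_simps)
    then have "D * exp (real l * \<alpha> n) + D' * exp (real l' * \<alpha> n)
        \<le> D * exp (real (l + l') * \<alpha> n) + D' * exp (real (l + l') * \<alpha> n)"
      using l(2) l'(2) by (intro add_mono mult_left_mono)
    moreover have "ps_norm \<beta> k (\<lambda>i. c n i + d n i) \<le> ps_norm \<beta> k (c n) + ps_norm \<beta> k (d n)"
      using c d n k by (intro ps_norm_add) (auto simp: col_bounded_def)
    ultimately show ?thesis
      using lD[OF n] lD'[OF n] by (simp add: distrib_right)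
  qed
  then show "\<exists>l\<ge>1. \<exists>D\<ge>0. \<forall>n\<ge>1. ps_norm \<beta> k (\<lambda>i. c n i + d n i) \<le> D * exp (real l * \<alpha> n)"
    using l l' by (intro exI[of _ "l + l'"] conjI exI[of _ "D + D'"]) auto
qed

text \<open>
  The triangle inequality for infinitely many summands: the double sum
  \<open>\<Sum>i. \<Sum>n. \<bar>x n\<bar> * \<bar>c n i\<bar> * exp (k * \<beta> i)\<close> is summed over \<open>n\<close> last. The index set \<open>I\<close> is
  arbitrary so that the estimate applies to the whole series and to its tails.
\<close>

lemma ps_norm_weighted_sum_le:
  fixes c :: "nat \<Rightarrow> nat \<Rightarrow> 'a::{real_normed_field, banach}"
  assumes c: "\<And>n. n \<in> I \<Longrightarrow> c n \<in> ps_space \<beta>" and k: "1 \<le> k"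
    and sm: "(\<lambda>n. norm (x n) * ps_norm \<beta> k (c n)) summable_on I"
  defines "z \<equiv> \<lambda>i. \<Sum>\<^sub>\<infinity>n\<in>I. x n * c n i"
  shows "\<And>i. 1 \<le> i \<Longrightarrow> (\<lambda>n. norm (x n * c n i)) summable_on I"
    and "(\<lambda>i. norm (z i) * exp (real k * \<beta> i)) summable_on {1..}"
    and "ps_norm \<beta> k z \<le> (\<Sum>\<^sub>\<infinity>n\<in>I. norm (x n) * ps_norm \<beta> k (c n))"
proof -
  let ?S = "\<Sum>\<^sub>\<infinity>n\<in>I. norm (x n) * ps_norm \<beta> k (c n)"
  have weighted: "(\<lambda>n. norm (x n * c n i) * exp (real k * \<beta> i)) summable_on I" if i: "1 \<le> i" for i
    using sm
  proof (rule summable_on_comparison_test)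
    fix n
    assume "n \<in> I"
    from mult_left_mono[OF coord_le_ps_norm[OF c[OF this] k i] norm_ge_zero[of "x n"]]
    show "norm (x n * c n i) * exp (real k * \<beta> i) \<le> norm (x n) * ps_norm \<beta> k (c n)"
      by (simp add: norm_mult mult_ac)
  qed simp
  show coord: "(\<lambda>n. norm (x n * c n i)) summable_on I" if "1 \<le> i" for i
    using summable_on_cmult_left[OF weighted[OF that], of "exp (- (real k * \<beta> i))"]
    by (simp add: mult.assoc exp_add[symmetric])
  have fin: "(\<Sum>i\<in>F. norm (z i) * exp (real k * \<beta> i)) \<le> ?S" if F: "finite F" "F \<subseteq> {1..}" for F
  proof -
    let ?h = "\<lambda>i n. norm (x n * c n i) * exp (real k * \<beta> i)"
    have "norm (z i) * exp (real k * \<beta> i) \<le> infsum (?h i) I" if "i \<in> F" for i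
    proof -
      have i: "1 \<le> i"
        using that F by auto
      have "norm (z i) \<le> (\<Sum>\<^sub>\<infinity>n\<in>I. norm (x n * c n i))"
        unfolding z_def by (rule norm_infsum_bound) (rule coord[OF i])
      then have "norm (z i) * exp (real k * \<beta> i)
          \<le> (\<Sum>\<^sub>\<infinity>n\<in>I. norm (x n * c n i)) * exp (real k * \<beta> i)"
        by simp
      also have "\<dots> = infsum (?h i) I"
        by (rule infsum_cmult_left'[symmetric])
      finally show ?thesis .
    qed
    then have "(\<Sum>i\<in>F. norm (z i) * exp (real k * \<beta> i)) \<le> (\<Sum>i\<in>F. infsum (?h i) I)"
      by (rule sum_mono)
    also have "\<dots> \<le> ?S"
    proof (rule has_sum_mono)
      show "((\<lambda>n. \<Sum>i\<in>F. ?h i n) has_sum (\<Sum>i\<in>F. infsum (?h i) I)) I"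
        using F by (intro has_sum_sum_finite has_sum_infsum weighted) auto
      show "((\<lambda>n. norm (x n) * ps_norm \<beta> k (c n)) has_sum ?S) I"
        by (rule has_sum_infsum[OF sm])
      fix n
      assume n: "n \<in> I"
      have "(\<Sum>i\<in>F. ?h i n) = norm (x n) * (\<Sum>i\<in>F. norm (c n i) * exp (real k * \<beta> i))"
        by (simp add: norm_mult sum_distrib_left mult.assoc)
      also have "\<dots> \<le> norm (x n) * ps_norm \<beta> k (c n)"
        by (intro mult_left_mono sum_le_ps_norm c n k F) simp
      finally show "(\<Sum>i\<in>F. ?h i n) \<le> norm (x n) * ps_norm \<beta> k (c n)" .
    qed
    finally show ?thesis .
  qed
  show s: "(\<lambda>i. norm (z i) * exp (real k * \<beta> i)) summable_on {1..}"
    by (rule nonneg_bdd_above_summable_on) (auto intro!: bdd_aboveI2[of _ _ ?S] fin)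
  show "ps_norm \<beta> k z \<le> ?S"
    unfolding ps_norm_def[of \<beta> k z] by (rule infsum_le_finite_sums[OF s fin])
qed

lemma col_bounded_summable:
  assumes c: "\<And>n. 1 \<le> n \<Longrightarrow> ps_norm \<beta> k (c n) \<le> D * exp (real l * \<alpha> n)"
    and x: "x \<in> ps_space \<alpha>" and l: "1 \<le> l"
  shows "(\<lambda>n. norm (x n) * ps_norm \<beta> k (c n)) summable_on {1..}"
    and "(\<Sum>\<^sub>\<infinity>n\<in>{1..}. norm (x n) * ps_norm \<beta> k (c n)) \<le> D * ps_norm \<alpha> l x"
proof -
  have le: "norm (x n) * ps_norm \<beta> k (c n) \<le> D * (norm (x n) * exp (real l * \<alpha> n))"
    if "n \<in> {1..}" for n
    using mult_left_mono[OF c[of n] norm_ge_zero[of "x n"]] that by (simp add: mult_ac)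
  have s: "(\<lambda>n. norm (x n) * exp (real l * \<alpha> n)) summable_on {1..}"
    using x l by (simp add: ps_space_def)
  show s': "(\<lambda>n. norm (x n) * ps_norm \<beta> k (c n)) summable_on {1..}"
    using summable_on_cmult_right[OF s, of D]
    by (rule summable_on_comparison_test) (use le in \<open>auto simp: ps_norm_nonneg\<close>)
  have "(\<Sum>\<^sub>\<infinity>n\<in>{1..}. norm (x n) * ps_norm \<beta> k (c n))
      \<le> (\<Sum>\<^sub>\<infinity>n\<in>{1..}. D * (norm (x n) * exp (real l * \<alpha> n)))"
    by (rule infsum_mono[OF s' summable_on_cmult_right[OF s] le])
  also have "\<dots> = D * ps_norm \<alpha> l x"
    unfolding ps_norm_def by (rule infsum_cmult_right')
  finally show "(\<Sum>\<^sub>\<infinity>n\<in>{1..}. norm (x n) * ps_norm \<beta> k (c n)) \<le> D * ps_norm \<alpha> l x" .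
qed

lemma col_bounded_coord_summable:
  fixes c :: "nat \<Rightarrow> nat \<Rightarrow> 'a::{real_normed_field, banach}"
  assumes c: "col_bounded \<alpha> \<beta> c" and x: "x \<in> ps_space \<alpha>"
  shows "(\<lambda>n. x n * c n i) summable_on {1..}"
proof (cases "i = 0")
  case True
  \<comment> \<open>Index \<open>0\<close> is outside the sequences; there all columns carry the default value \<open>0\<close>.\<close>
  then have zero: "x n * c n i = 0" if "n \<in> {1..}" for n
    using c that by (simp add: col_bounded_def ps_space_def)
  have "(\<lambda>n. x n * c n i) summable_on {1..} \<longleftrightarrow> (\<lambda>n. 0 :: 'a) summable_on {1::nat..}"
    by (rule summable_on_cong) (rule zero)
  then show ?thesis
    by simp
next
  case False
  obtain l D where "1 \<le> l"
    and "\<And>n. 1 \<le> n \<Longrightarrow> ps_norm \<beta> 1 (c n) \<le> D * exp (real l * \<alpha> n)"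
    using c unfolding col_bounded_def by (meson order_refl)
  note s = col_bounded_summable(1)[OF this(2) x this(1)]
  show ?thesis
    by (rule abs_summable_summable, rule ps_norm_weighted_sum_le(1)[OF _ _ s])
      (use c False in \<open>auto simp: col_bounded_def\<close>)
qed

lemma col_sum_in_ps_space:
  assumes c: "col_bounded \<alpha> \<beta> c" and x: "x \<in> ps_space \<alpha>"
  shows "col_sum c x \<in> ps_space \<beta>"
  unfolding ps_space_def
proof (intro CollectI conjI allI impI)
  show "col_sum c x 0 = 0"
    using c unfolding col_sum_def
    by (intro infsum_0) (auto simp: col_bounded_def ps_space_def)
  fix k :: nat
  assume k: "1 \<le> k"
  obtain l D where "1 \<le> l"
    and "\<And>n. 1 \<le> n \<Longrightarrow> ps_norm \<beta> k (c n) \<le> D * exp (real l * \<alpha> n)"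
    using c k unfolding col_bounded_def by meson
  note s = col_bounded_summable(1)[OF this(2) x this(1)]
  show "(\<lambda>i. norm (col_sum c x i) * exp (real k * \<beta> i)) summable_on {1..}"
    unfolding col_sum_def
    by (rule ps_norm_weighted_sum_le(2)[OF _ k s]) (use c in \<open>auto simp: col_bounded_def\<close>)
qed

lemma col_sum_diff:
  assumes c: "col_bounded \<alpha> \<beta> c" and v: "v \<in> ps_space \<alpha>" and w: "w \<in> ps_space \<alpha>"
  shows "col_sum c v i - col_sum c w i = col_sum c (\<lambda>n. v n - w n) i"
proof -
  have s: "((\<lambda>n. x n * c n i) has_sum col_sum c x i) {1..}" if "x \<in> ps_space \<alpha>" for x
    unfolding col_sum_def by (intro has_sum_infsum col_bounded_coord_summable[OF c] that)
  have "((\<lambda>n. - (w n * c n i)) has_sum - col_sum c w i) {1..}"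
    using s[OF w] by (simp add: has_sum_uminus)
  from has_sum_add[OF s[OF v] this]
  have "((\<lambda>n. (v n - w n) * c n i) has_sum (col_sum c v i - col_sum c w i)) {1..}"
    by (simp add: left_diff_distrib)
  from infsumI[OF this] show ?thesis
    by (simp add: col_sum_def)
qed

lemma continuous_map_col_sum:
  fixes c :: "nat \<Rightarrow> nat \<Rightarrow> 'a::{real_normed_field, banach}"
  assumes c: "col_bounded \<alpha> \<beta> c"
  shows "continuous_map (ps_top \<alpha>) (ps_top \<beta>) (col_sum c)"
proof (rule continuous_map_ps_topI)
  fix k :: nat
  assume k: "1 \<le> k"
  obtain l D where l: "1 \<le> l" "0 \<le> D"
    and lD: "\<And>n. 1 \<le> n \<Longrightarrow> ps_norm \<beta> k (c n) \<le> D * exp (real l * \<alpha> n)"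
    using c k unfolding col_bounded_def by meson
  have "ps_norm \<beta> k (\<lambda>i. col_sum c v i - col_sum c w i) \<le> D * ps_norm \<alpha> l (\<lambda>n. v n - w n)"
    if v: "v \<in> ps_space \<alpha>" and w: "w \<in> ps_space \<alpha>" for v w :: "nat \<Rightarrow> 'a"
  proof -
    note s = col_bounded_summable[OF lD ps_space_diff[OF v w] l(1)]
    have "ps_norm \<beta> k (col_sum c (\<lambda>n. v n - w n))
        \<le> (\<Sum>\<^sub>\<infinity>n\<in>{1..}. norm (v n - w n) * ps_norm \<beta> k (c n))"
      unfolding col_sum_def
      by (rule ps_norm_weighted_sum_le(3)[OF _ k s(1)]) (use c in \<open>auto simp: col_bounded_def\<close>)
    with s(2) show ?thesis
      by (simp add: col_sum_diff[OF c v w])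
  qed
  with l show "\<exists>l\<ge>1. \<exists>D\<ge>0. \<forall>v\<in>ps_space \<alpha>. \<forall>w\<in>ps_space \<alpha>.
      ps_norm \<beta> k (\<lambda>n. col_sum c v n - col_sum c w n) \<le> D * ps_norm \<alpha> l (\<lambda>n. v n - w n)"
    by blast
qed (rule col_sum_in_ps_space[OF c])

lemma infsum_tail_tendsto_zero:
  fixes g :: "nat \<Rightarrow> real"
  assumes "g summable_on {1..}"
  shows "(\<lambda>N. infsum g ({1..} - {1..N})) \<longlonglongrightarrow> 0"
proof -
  have "filterlim (\<lambda>N. {1..N}) (finite_subsets_at_top {1::nat..}) sequentially"
    unfolding filterlim_finite_subsets_at_top
  proof (intro allI impI)
    fix X :: "nat set"
    assume X: "finite X \<and> X \<subseteq> {1..}"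
    then obtain m where "X \<subseteq> {..m}"
      by (auto simp: finite_nat_set_iff_bounded_le)
    with X have "finite {1..N} \<and> X \<subseteq> {1..N} \<and> {1..N} \<subseteq> {1..}" if "m \<le> N" for N
      using that by fastforce
    then show "\<forall>\<^sub>F N in sequentially. finite {1..N} \<and> X \<subseteq> {1..N} \<and> {1..N} \<subseteq> {1..}"
      using eventually_ge_at_top[of m] by (rule eventually_mono[rotated])
  qed
  with has_sum_infsum[OF assms] have "(\<lambda>N. sum g {1..N}) \<longlonglongrightarrow> infsum g {1..}"
    unfolding has_sum_def by (rule filterlim_compose)
  from tendsto_diff[OF tendsto_const[of "infsum g {1..}"] this]
  have "(\<lambda>N. infsum g {1..} - sum g {1..N}) \<longlonglongrightarrow> 0"
    by simp
  moreover have "infsum g ({1..} - {1..N}) = infsum g {1..} - sum g {1..N}" for N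
    using infsum_Diff[OF assms, of "{1..N}"] by simp
  ultimately show ?thesis
    by simp
qed

lemma limitin_col_sum:
  assumes c: "col_bounded \<alpha> \<beta> c" and x: "x \<in> ps_space \<alpha>"
  shows "limitin (ps_top \<beta>) (col_partial_sum c x) (col_sum c x) sequentially"
proof (rule limitin_ps_topI)
  show y: "col_sum c x \<in> ps_space \<beta>"
    by (rule col_sum_in_ps_space[OF c x])
  show "col_partial_sum c x N \<in> ps_space \<beta>" for N
  proof -
    have "(\<lambda>i. \<Sum>n<N. x (Suc n) * c (Suc n) i) \<in> ps_space \<beta>"
      by (rule ps_space_sum) (use c in \<open>auto simp: col_bounded_def\<close>)
    then show ?thesis
      by (simp add: col_partial_sum_def sum.atLeast1_atMost_eq)
  qed
  fix k :: nat
  assume k: "1 \<le> k"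
  obtain l D where "1 \<le> l"
    and "\<And>n. 1 \<le> n \<Longrightarrow> ps_norm \<beta> k (c n) \<le> D * exp (real l * \<alpha> n)"
    using c k unfolding col_bounded_def by meson
  note s = col_bounded_summable(1)[OF this(2) x this(1)]
  let ?tail = "\<lambda>N. \<Sum>\<^sub>\<infinity>n\<in>{1..} - {1..N}. norm (x n) * ps_norm \<beta> k (c n)"
  have "ps_norm \<beta> k (\<lambda>i. col_partial_sum c x N i - col_sum c x i) \<le> ?tail N" for N
  proof -
    have "col_sum c x i - col_partial_sum c x N i = (\<Sum>\<^sub>\<infinity>n\<in>{1..} - {1..N}. x n * c n i)" for i
      using infsum_Diff[OF col_bounded_coord_summable[OF c x], of _ "{1..N}"]
      by (simp add: col_sum_def col_partial_sum_def)
    moreover have "ps_norm \<beta> k (\<lambda>i. \<Sum>\<^sub>\<infinity>n\<in>{1..} - {1..N}. x n * c n i) \<le> ?tail N"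
      using c by (intro ps_norm_weighted_sum_le(3) k summable_on_subset[OF s])
        (auto simp: col_bounded_def)
    ultimately show ?thesis
      by (subst ps_norm_minus_commute) simp
  qed
  then show "(\<lambda>N. ps_norm \<beta> k (\<lambda>i. col_partial_sum c x N i - col_sum c x i)) \<longlonglongrightarrow> 0"
    by (intro tendsto_sandwich[OF _ _ tendsto_const infsum_tail_tendsto_zero[OF s]])
      (auto simp: ps_norm_nonneg)
qed

lemma col_bounded_imp_well_defined:
  assumes "col_bounded \<alpha> \<beta> c"
  shows "col_op_well_defined \<alpha> \<beta> c"
  using assms limitin_col_sum[OF assms] unfolding col_op_well_defined_def col_bounded_def by blast

lemma col_op_eq_col_sum:
  assumes "col_bounded \<alpha> \<beta> c" "x \<in> ps_space \<alpha>"
  shows "col_op \<beta> c x = col_sum c x"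
  unfolding col_op_def
  using limitin_col_sum[OF assms] by (intro the_equality) (auto intro: ps_top_limit_unique)

section \<open>Columns of triangular Toeplitz matrices\<close>

text \<open>
  A bound for large \<open>n\<close> suffices, because \<open>exp (m * \<alpha> n) \<ge> 1\<close> takes care of finitely many indices.
\<close>

lemma exp_dominated_all:
  assumes \<alpha>: "exponent_seq \<alpha>"
    and dom: "\<forall>k::nat\<ge>1. \<exists>m::nat\<ge>1. \<exists>C>0. \<forall>n\<ge>k. exp (real k * \<beta> n) \<le> C * exp (real m * \<alpha> n)"
    and k: "1 \<le> k"
  obtains m :: nat and C :: real where "1 \<le> m" "0 < C"
    "\<And>n. 1 \<le> n \<Longrightarrow> exp (real k * \<beta> n) \<le> C * exp (real m * \<alpha> n)"
proof -
  obtain m C where m: "1 \<le> m" and C: "0 < C"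
    and mC: "\<And>n. k \<le> n \<Longrightarrow> exp (real k * \<beta> n) \<le> C * exp (real m * \<alpha> n)"
    using dom k by meson
  let ?C = "C + (\<Sum>n<k. exp (real k * \<beta> n))"
  have s: "0 \<le> (\<Sum>n<k. exp (real k * \<beta> n))"
    by (rule sum_nonneg) simp
  have "exp (real k * \<beta> n) \<le> ?C * exp (real m * \<alpha> n)" if n: "1 \<le> n" for n
  proof (cases "k \<le> n")
    case True
    have "C * exp (real m * \<alpha> n) \<le> ?C * exp (real m * \<alpha> n)"
      using s by (intro mult_right_mono) auto
    with mC[OF True] show ?thesis
      by linarith
  next
    case False
    then have "exp (real k * \<beta> n) \<le> (\<Sum>n<k. exp (real k * \<beta> n))"
      by (intro member_le_sum) auto
    also have "\<dots> \<le> ?C"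
      using C by simp
    also have "?C \<le> ?C * exp (real m * \<alpha> n)"
      using \<alpha> n C s by (simp add: exponent_seq_def mult_le_cancel_left1)
    finally show ?thesis .
  qed
  with m C s show ?thesis
    by (intro that[of m ?C]) auto
qed

text \<open>
  Among \<open>exp (- q * \<alpha> 1), \<dots>, exp (- q * \<alpha> n)\<close> the last one is the smallest, so \<open>n\<close> times it is at
  most the sum of the convergent series of the Grothendieck--Pietsch criterion.
\<close>

lemma nuclear_imp_index_le_exp:
  fixes \<alpha> :: "nat \<Rightarrow> real"
  assumes \<alpha>: "exponent_seq \<alpha>"
    and nuc: "nuclear_space (ps_space \<alpha> :: (nat \<Rightarrow> 'a::{real_normed_field, banach}) set) (ps_norm \<alpha>)"
  obtains q :: nat and D :: real
    where "0 \<le> D" "\<And>n. 1 \<le> n \<Longrightarrow> real n \<le> D * exp (real q * \<alpha> n)"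
proof -
  obtain l :: nat where l: "1 < l"
    and s: "(\<lambda>n. exp ((real 1 - real l) * \<alpha> n)) summable_on {1..}"
    using nuc nuclear_ps_space_iff[OF \<alpha>, where 'a = 'a] by blast
  define q where "q = l - 1"
  have "real 1 - real l = - real q"
    using l by (simp add: q_def of_nat_diff)
  with s have s': "(\<lambda>n. exp (- real q * \<alpha> n)) summable_on {1..}"
    by simp
  define D where "D = (\<Sum>\<^sub>\<infinity>n\<in>{1..}. exp (- real q * \<alpha> n))"
  have "real n \<le> D * exp (real q * \<alpha> n)" if "1 \<le> n" for n
  proof -
    have "(\<Sum>j\<in>{1..n}. exp (- real q * \<alpha> n)) \<le> (\<Sum>j\<in>{1..n}. exp (- real q * \<alpha> j))"
    proof (rule sum_mono)
      fix j
      assume "j \<in> {1..n}"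
      then have "\<alpha> j \<le> \<alpha> n"
        using \<alpha> by (auto simp: exponent_seq_def mono_on_def)
      then show "exp (- real q * \<alpha> n) \<le> exp (- real q * \<alpha> j)"
        by (simp add: mult_left_mono)
    qed
    also have "\<dots> \<le> D"
      unfolding D_def by (rule finite_sum_le_infsum[OF s']) auto
    finally have "real n * exp (- (real q * \<alpha> n)) * exp (real q * \<alpha> n) \<le> D * exp (real q * \<alpha> n)"
      by (intro mult_right_mono) auto
    then show ?thesis
      by (simp add: mult.assoc exp_add[symmetric])
  qed
  moreover have "0 \<le> D"
    unfolding D_def by (rule infsum_nonneg) simp
  ultimately show ?thesis
    by (intro that)
qed

text \<open>
  Both \<open>n\<close> and \<open>i\<close> are bounded by their maximum, so the index \<open>n + i - 1\<close> is less than twice that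
  maximum.
\<close>

lemma stable_seq_subadditive:
  assumes \<beta>: "exponent_seq \<beta>" and "stable_seq \<beta>"
  obtains M :: nat where "1 \<le> M"
    "\<And>n i. 1 \<le> n \<Longrightarrow> 1 \<le> i \<Longrightarrow> \<beta> (n + i - 1) \<le> real M * (\<beta> n + \<beta> i)"
proof -
  obtain M0 where M0: "\<And>n. 1 \<le> n \<Longrightarrow> \<beta> (2 * n) \<le> M0 * \<beta> n"
    using assms(2) unfolding stable_seq_def by blast
  define M where "M = max 1 (nat \<lceil>M0\<rceil>)"
  have M: "M0 \<le> real M"
    unfolding M_def by linarith
  have "\<beta> (n + i - 1) \<le> real M * (\<beta> n + \<beta> i)" if n: "1 \<le> n" and i: "1 \<le> i" for n i
  proof -
    have nonneg: "0 \<le> \<beta> n" "0 \<le> \<beta> i" "0 \<le> \<beta> (max n i)"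
      using \<beta> n i by (auto simp: exponent_seq_def)
    have "\<beta> (n + i - 1) \<le> \<beta> (2 * max n i)"
      using \<beta> n i by (intro mono_onD[of "{1..}" \<beta>]) (auto simp: exponent_seq_def)
    also have "\<dots> \<le> M0 * \<beta> (max n i)"
      using n by (intro M0) auto
    also have "\<dots> \<le> real M * \<beta> (max n i)"
      using M nonneg by (intro mult_right_mono)
    also have "\<dots> \<le> real M * (\<beta> n + \<beta> i)"
      using nonneg by (intro mult_left_mono) (auto simp: max_def)
    finally show ?thesis .
  qed
  then show ?thesis
    by (intro that[of M]) (auto simp: M_def)
qed

lemma col_bounded_lower_col:
  fixes \<eta> :: "nat \<Rightarrow> 'a::{real_normed_field, banach}"
  assumes \<alpha>: "exponent_seq \<alpha>" and \<beta>: "exponent_seq \<beta>" "stable_seq \<beta>"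
    and \<eta>: "as_seq \<eta> \<in> ps_space \<beta>"
    and dom: "\<forall>k::nat\<ge>1. \<exists>m::nat\<ge>1. \<exists>C>0. \<forall>n\<ge>k. exp (real k * \<beta> n) \<le> C * exp (real m * \<alpha> n)"
  shows "col_bounded \<alpha> \<beta> (lower_col \<eta>)"
proof (rule col_boundedI)
  fix k :: nat
  assume k: "1 \<le> k"
  obtain M :: nat where M: "1 \<le> M"
    and add: "\<And>n i. 1 \<le> n \<Longrightarrow> 1 \<le> i \<Longrightarrow> \<beta> (n + i - 1) \<le> real M * (\<beta> n + \<beta> i)"
    using stable_seq_subadditive[OF \<beta>] by blast
  have kM: "1 \<le> k * M"
    using k M by simp
  obtain m :: nat and C :: real where m: "1 \<le> m" and C: "0 < C"
    and mC: "\<And>n. 1 \<le> n \<Longrightarrow> exp (real (k * M) * \<beta> n) \<le> C * exp (real m * \<alpha> n)"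
    using exp_dominated_all[OF \<alpha> dom kM] by blast
  define h where "h i = norm (as_seq \<eta> i) * exp (real (k * M) * \<beta> i)" for i
  define S where "S = infsum h {1..}"
  have hS: "(h has_sum S) {1..}"
    using \<eta> kM unfolding S_def h_def ps_space_def by (intro has_sum_infsum) blast
  have S: "0 \<le> S"
    unfolding S_def h_def by (rule infsum_nonneg) simp
  have "\<exists>g S'. (g has_sum S') {1..} \<and>
      (\<forall>j\<ge>1. norm (lower_col \<eta> n j) * exp (real k * \<beta> j) \<le> g j) \<and> S' \<le> (C * S) * exp (real m * \<alpha> n)"
    if n: "1 \<le> n" for n
  proof -
    define E where "E = exp (real (k * M) * \<beta> n)"
    define g where "g j = (if n \<le> j then E * h (j - n + 1) else 0)" for j
    have "bij_betw (\<lambda>j. j - n + 1) {n..} {1..}"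
      by (rule bij_betwI[where g = "\<lambda>i. n + i - 1"]) auto
    with hS have "((\<lambda>j. h (j - n + 1)) has_sum S) {n..}"
      by (subst has_sum_reindex_bij_betw)
    from has_sum_cmult_right[OF this, of E]
    have "(g has_sum E * S) {1..} "
      by (rule has_sum_cong_neutral[THEN iffD1, rotated -1]) (use n in \<open>auto simp: g_def\<close>)
    moreover have "norm (lower_col \<eta> n j) * exp (real k * \<beta> j) \<le> g j" if "1 \<le> j" for j
    proof (cases "n \<le> j")
      case True
      then have "\<beta> j \<le> real M * (\<beta> n + \<beta> (j - n + 1))"
        using add[OF n, of "j - n + 1"] by simp
      from mult_left_mono[OF this, of "real k"]
      have "exp (real k * \<beta> j) \<le> E * exp (real (k * M) * \<beta> (j - n + 1))"
        by (simp add: E_def exp_add[symmetric] algebra_simps)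
      from mult_left_mono[OF this, of "norm (\<eta> (j - n))"] True show ?thesis
        by (simp add: g_def h_def lower_col_def as_seq_def mult_ac)
    qed (simp add: g_def lower_col_def)
    moreover have "E * S \<le> (C * S) * exp (real m * \<alpha> n)"
      using mult_right_mono[OF mC[OF n] S] by (simp add: E_def mult_ac)
    ultimately show ?thesis
      by blast
  qed
  with m C S show "\<exists>l\<ge>1. \<exists>D\<ge>0. \<forall>n\<ge>1. \<exists>g S. (g has_sum S) {1..} \<and>
      (\<forall>j\<ge>1. norm (lower_col \<eta> n j) * exp (real k * \<beta> j) \<le> g j) \<and> S \<le> D * exp (real l * \<alpha> n)"
    by (intro exI[of _ m] conjI exI[of _ "C * S"]) auto
qed (simp add: lower_col_def)

lemma col_bounded_upper_col:
  fixes \<eta> :: "nat \<Rightarrow> 'a::{real_normed_field, banach}"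
  assumes \<alpha>: "exponent_seq \<alpha>" and \<beta>: "exponent_seq \<beta>"
    and nuc: "nuclear_space (ps_space \<alpha> :: (nat \<Rightarrow> 'a) set) (ps_norm \<alpha>)"
    and \<eta>: "as_seq \<eta> \<in> ps_dual \<alpha>"
    and dom: "\<forall>k::nat\<ge>1. \<exists>m::nat\<ge>1. \<exists>C>0. \<forall>n\<ge>k. exp (real k * \<beta> n) \<le> C * exp (real m * \<alpha> n)"
  shows "col_bounded \<alpha> \<beta> (upper_col \<eta>)"
proof (rule col_boundedI)
  fix k :: nat
  assume k: "1 \<le> k"
  obtain m :: nat and C :: real where m: "1 \<le> m" and C: "0 < C"
    and mC: "\<And>n. 1 \<le> n \<Longrightarrow> exp (real k * \<beta> n) \<le> C * exp (real m * \<alpha> n)"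
    using exp_dominated_all[OF \<alpha> dom k] by blast
  obtain q :: nat and D :: real where D: "0 \<le> D"
    and qD: "\<And>n. 1 \<le> n \<Longrightarrow> real n \<le> D * exp (real q * \<alpha> n)"
    using nuclear_imp_index_le_exp[OF \<alpha> nuc] by blast
  obtain p :: nat and B :: real
    where pB: "\<And>n. 1 \<le> n \<Longrightarrow> norm (as_seq \<eta> n) * exp (- real p * \<alpha> n) \<le> B"
    using \<eta> by (auto simp: ps_dual_def bdd_above_def)
  have B: "0 \<le> B"
    by (rule order_trans[OF _ pB[of 1]]) auto
  have mono: "\<gamma> i \<le> \<gamma> n" if "exponent_seq \<gamma>" "1 \<le> i" "i \<le> n" for \<gamma> :: "nat \<Rightarrow> real" and i n
    using that by (auto simp: exponent_seq_def mono_on_def)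
  have \<eta>_le: "norm (\<eta> (n - j)) \<le> B * exp (real p * \<alpha> n)" if j: "1 \<le> j" "j \<le> n" for n j
  proof -
    have "norm (\<eta> (n - j)) * exp (- real p * \<alpha> (n - j + 1)) \<le> B"
      using pB[of "n - j + 1"] by (simp add: as_seq_def)
    then have "norm (\<eta> (n - j)) \<le> B * exp (real p * \<alpha> (n - j + 1))"
      by (simp add: exp_minus field_simps)
    also have "\<dots> \<le> B * exp (real p * \<alpha> n)"
      using B j by (intro mult_left_mono) (auto intro!: mult_left_mono mono[OF \<alpha>])
    finally show ?thesis .
  qed
  have "\<exists>g S. (g has_sum S) {1..} \<and>
      (\<forall>j\<ge>1. norm (upper_col \<eta> n j) * exp (real k * \<beta> j) \<le> g j) \<and>
      S \<le> (D * B * C) * exp (real (q + p + m) * \<alpha> n)"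
    if n: "1 \<le> n" for n
  proof -
    define G where "G = (B * exp (real p * \<alpha> n)) * (C * exp (real m * \<alpha> n))"
    define g where "g j = (if j \<le> n then G else 0)" for j
    have G: "0 \<le> G"
      using B C by (simp add: G_def)
    have "((\<lambda>j. G) has_sum real n * G) {1..n}"
      by (rule has_sum_finiteI) auto
    then have "(g has_sum real n * G) {1..}"
      by (rule has_sum_cong_neutral[THEN iffD1, rotated -1]) (auto simp: g_def)
    moreover have "norm (upper_col \<eta> n j) * exp (real k * \<beta> j) \<le> g j" if j: "1 \<le> j" for j
    proof (cases "j \<le> n")
      case True
      have "exp (real k * \<beta> j) \<le> exp (real k * \<beta> n)"
        using mono[OF \<beta> j True] by (simp add: mult_left_mono)
      then have "exp (real k * \<beta> j) \<le> C * exp (real m * \<alpha> n)"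
        using mC[OF n] by (rule order_trans)
      with \<eta>_le[OF j True] have "norm (\<eta> (n - j)) * exp (real k * \<beta> j) \<le> G"
        unfolding G_def using B by (intro mult_mono) auto
      with True j show ?thesis
        by (simp add: g_def upper_col_def)
    qed (simp add: g_def upper_col_def)
    moreover have "real n * G \<le> (D * B * C) * exp (real (q + p + m) * \<alpha> n)"
    proof -
      have "real n * G \<le> D * exp (real q * \<alpha> n) * G"
        by (rule mult_right_mono[OF qD[OF n] G])
      also have "\<dots> = (D * B * C) * exp (real (q + p + m) * \<alpha> n)"
        by (simp add: G_def distrib_left distrib_right exp_add mult_ac)
      finally show ?thesis .
    qed
    ultimately show ?thesis
      by blast
  qed
  with m B C D show "\<exists>l\<ge>1. \<exists>D\<ge>0. \<forall>n\<ge>1. \<exists>g S. (g has_sum S) {1..} \<and>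
      (\<forall>j\<ge>1. norm (upper_col \<eta> n j) * exp (real k * \<beta> j) \<le> g j) \<and> S \<le> D * exp (real l * \<alpha> n)"
    by (intro exI[of _ "q + p + m"] conjI exI[of _ "D * B * C"]) auto
qed (simp add: upper_col_def)

section \<open>Toeplitz operators\<close>

theorem theorem5p3:
  fixes \<alpha> \<beta> :: "nat \<Rightarrow> real"
    and \<theta> :: "int \<Rightarrow> 'a::{real_normed_field, banach}"
    and a b :: 'a
  assumes "exponent_seq \<alpha>" and "exponent_seq \<beta>"
    and "stable_seq \<beta>"
    and "nuclear_space (ps_space \<alpha> :: (nat \<Rightarrow> 'a) set) (ps_norm \<alpha>)"
    and "\<theta> 0 = a + b" and "a \<noteq> 0" and "b \<noteq> 0"
    and "infinite {j. hat_part \<theta> a j \<noteq> 0}" and "infinite {j. check_part \<theta> b j \<noteq> 0}"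
    and "as_seq (hat_part \<theta> a) \<in> ps_space \<beta>"
    and "as_seq (check_part \<theta> b) \<in> ps_dual \<alpha>"
    and "\<forall>k::nat\<ge>1. \<exists>m::nat\<ge>1. \<exists>C>0. \<forall>n\<ge>k. exp (real k * \<beta> n) \<le> C * exp (real m * \<alpha> n)"
  shows "toeplitz_well_defined \<alpha> \<beta> \<theta> a b \<and>
    continuous_map (ps_top \<alpha>) (ps_top \<beta>) (toeplitz_op \<beta> \<theta> a b)"
proof
  let ?L = "lower_col (hat_part \<theta> a)" and ?U = "upper_col (check_part \<theta> b)"
  have L: "col_bounded \<alpha> \<beta> ?L"
    by (intro col_bounded_lower_col assms)
  have U: "col_bounded \<alpha> \<beta> ?U"
    by (intro col_bounded_upper_col assms)
  show "toeplitz_well_defined \<alpha> \<beta> \<theta> a b"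
    unfolding toeplitz_well_defined_def
    using col_bounded_imp_well_defined[OF L] col_bounded_imp_well_defined[OF U] by blast
  \<comment> \<open>Continuity is read off from the full Toeplitz matrix, whose columns are the sums of the columns
    of the two triangular parts.\<close>
  have "col_sum (\<lambda>n i. ?L n i + ?U n i) x = toeplitz_op \<beta> \<theta> a b x" if x: "x \<in> ps_space \<alpha>" for x
  proof
    fix i
    have "toeplitz_op \<beta> \<theta> a b x i = col_sum ?L x i + col_sum ?U x i"
      unfolding toeplitz_op_def col_op_eq_col_sum[OF L x] col_op_eq_col_sum[OF U x] ..
    also have "\<dots> = col_sum (\<lambda>n i. ?L n i + ?U n i) x i"
      unfolding col_sum_def distrib_left
      by (intro infsum_add[symmetric] col_bounded_coord_summable[OF L x]
          col_bounded_coord_summable[OF U x])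
    finally show "col_sum (\<lambda>n i. ?L n i + ?U n i) x i = toeplitz_op \<beta> \<theta> a b x i" ..
  qed
  then show "continuous_map (ps_top \<alpha>) (ps_top \<beta>) (toeplitz_op \<beta> \<theta> a b)"
    using continuous_map_col_sum[OF col_bounded_add[OF assms(1) L U]]
    by (rule continuous_map_eq[rotated]) simp
qed

end
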